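(* Let $0<q<p\le 1$ and let $\phi$ be analytic in $\mathbb{U}$ with $\Re(\phi(z))>0$ for $z\in\mathbb{U}$, $\phi(0)=1$, $\phi'(0)>0$, and $\phi(z)=1+b_1z+b_2z^2+\cdots$ with real coefficients, $b_1>0$ and $b_2\ge 0$. Let $$\sigma_1=\frac{([2]_{p,q}-1)b_1^2+([2]_{p,q}-1)^2(b_2-b_1)}{([3]_{p,q}-1)b_1^2},$$ $$\sigma_2=\frac{([2]_{p,q}-1)b_1^2+([2]_{p,q}-1)^2(b_2+b_1)}{([3]_{p,q}-1)b_1^2},$$ $$\sigma_3=\frac{([2]_{p,q}-1)b_1^2+([2]_{p,q}-1)^2b_2}{([3]_{p,q}-1)b_1^2}.$$ Let $\mu\in\mathbb{R}$. If $f(z)=z+\sum_{n=2}^{\infty}a_nz^n$ belongs to the class $\mathcal{S}^{*}_{p,q}(\phi)$, then $$|a_3-\mu a_2^2|\le\begin{cases}\dfrac{b_2}{[3]_{p,q}-1}+\dfrac{b_1^2}{[2]_{p,q}-1}\left(\dfrac{1}{[3]_{p,q}-1}-\dfrac{\mu}{[2]_{p,q}-1}\right), & \text{if }\mu\le\sigma_1,\\[2mm] \dfrac{b_1}{[3]_{p,q}-1}, & \text{if }\sigma_1\le\mu\le\sigma_2,\\[2mm] \dfrac{-b_2}{[3]_{p,q}-1}-\dfrac{b_1^2}{[2]_{p,q}-1}\left(\dfrac{1}{[3]_{p,q}-1}-\dfrac{\mu}{[2]_{p,q}-1}\right), & \text{if }\mu\ge\sigma_2.\end{cases}$$ Further,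 if $\sigma_1<\mu\le\sigma_3$, then $$|a_3-\mu a_2^2|+\frac{([2]_{p,q}-1)^2}{([3]_{p,q}-1)b_1^2}\left[b_1-b_2-\frac{b_1^2}{[2]_{p,q}-1}\left(1-\frac{[3]_{p,q}-1}{[2]_{p,q}-1}\mu\right)\right]|a_2|^2\le\frac{b_1}{[3]_{p,q}-1},$$ and if $\sigma_3\le\mu<\sigma_2$, then $$|a_3-\mu a_2^2|+\frac{([2]_{p,q}-1)^2}{([3]_{p,q}-1)b_1^2}\left[b_1+b_2+\frac{b_1^2}{[2]_{p,q}-1}\left(1-\frac{[3]_{p,q}-1}{[2]_{p,q}-1}\mu\right)\right]|a_2|^2\le\frac{b_1}{[3]_{p,q}-1}.$$
   Context: $\mathbb{U}=\{z\in\mathbb{C}:|z|<1\}$. $\mathcal{A}$ is the class of functions $f(z)=z+\sum_{n=2}^{\infty}a_nz^n$ analytic in $\mathbb{U}$. For $0<q<p\le1$, $[n]_{p,q}=\frac{p^n-q^n}{p-q}$. The $(p,q)$-derivative is $D_{p,q}f(z)=\frac{f(pz)-f(qz)}{(p-q)z}$ for $z\ne0$; for $f\in\mathcal{A}$ this is $D_{p,q}f(z)=1+\sum_{n=2}^{\infty}[n]_{p,q}a_nz^{n-1}$ (which also gives the value at $z=0$). For $g,F$ analytic in $\mathbb{U}$, $g$ is subordinate to $F$, written $g\prec F$, if there is a Schwarz function $w$, i.e. $w$ analytic in $\mathbb{U}$ with $w(0)=0$ and $|w(z)|<1$, such that $g(z)=F(w(z))$ for all $z\in\mathbb{U}$.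 For $\phi$ analytic in $\mathbb{U}$ with $\Re(\phi(z))>0$, $\phi(0)=1$, $\phi'(0)>0$, the class $\mathcal{S}^{*}_{p,q}(\phi)$ of $(p,q)$-starlike functions consists of all $f\in\mathcal{A}$ with $\frac{zD_{p,q}f(z)}{f(z)}\prec\phi(z)$ (the quotient being given its limit value $1$ at $z=0$).
   Formalization: The formal theorem assumes [3]_{p,q} > 1 (hence [2]_{p,q} > 1): if [3]_{p,q} = 1 or [2]_{p,q} = 1 the formulas divide by zero, and if [3]_{p,q} < 1 the function f(z) = z violates the third bound at μ = σ_2. *)

theory Defs
  imports "HOL-Complex_Analysis.Complex_Analysis"
begin

abbreviation unit_disc :: "complex set" where
  "unit_disc \<equiv> ball 0 1"

definition class_A :: "(complex \<Rightarrow> complex) set" where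
  "class_A = {f. f holomorphic_on unit_disc \<and>
     (\<exists>a. \<forall>z\<in>unit_disc. (\<lambda>n. a (n + 2) * z ^ (n + 2)) sums (f z - z))}"

definition pq_num :: "real \<Rightarrow> real \<Rightarrow> nat \<Rightarrow> real" where
  "pq_num p q n = (p ^ n - q ^ n) / (p - q)"

text \<open>The value at the origin is the one given by the power series of the
  \<open>(p, q)\<close>-derivative, whose constant term is \<open>f' 0\<close> (so \<open>1\<close> on \<open>class_A\<close>).\<close>

definition pq_deriv :: "real \<Rightarrow> real \<Rightarrow> (complex \<Rightarrow> complex) \<Rightarrow> complex \<Rightarrow> complex" where
  "pq_deriv p q f z =
     (if z = 0 then deriv f 0
      else (f (of_real p * z) - f (of_real q * z)) / (of_real (p - q) * z))"

definition schwarz_function :: "(complex \<Rightarrow> complex) \<Rightarrow> bool" where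
  "schwarz_function w \<longleftrightarrow>
     w holomorphic_on unit_disc \<and> w 0 = 0 \<and> (\<forall>z\<in>unit_disc. norm (w z) < 1)"

definition subordinate :: "(complex \<Rightarrow> complex) \<Rightarrow> (complex \<Rightarrow> complex) \<Rightarrow> bool" where
  "subordinate g F \<longleftrightarrow>
     g holomorphic_on unit_disc \<and> F holomorphic_on unit_disc \<and>
     (\<exists>w. schwarz_function w \<and> (\<forall>z\<in>unit_disc. g z = F (w z)))"

text \<open>The quotient \<open>z D f(z) / f(z)\<close> carries its limit value \<open>1\<close> at the origin. At a zero
  \<open>z \<noteq> 0\<close> of \<open>f\<close> it is \<open>0\<close> by the convention for division; when \<open>\<phi>\<close> has positive real part
  this value is not attained by \<open>\<phi>\<close>, so such \<open>f\<close> are not \<open>(p, q)\<close>-starlike.\<close>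

definition pq_starlike :: "real \<Rightarrow> real \<Rightarrow> (complex \<Rightarrow> complex) \<Rightarrow> (complex \<Rightarrow> complex) set" where
  "pq_starlike p q \<phi> =
     {f \<in> class_A. subordinate (\<lambda>z. if z = 0 then 1 else z * pq_deriv p q f z / f z) \<phi>}"

end

(*
  Comparing coefficients in f (p z) - f (q z) = (p - q) f z \<phi> (w z), where w z = c1 z + c2 z^2 + ...
  is the Schwarz function of the subordination, expresses a2 and a3 through c1 and c2 and gives
  a3 - \<mu> a2^2 = b1 / ([3] - 1) (c2 + \<nu> c1^2) with \<nu> real and affine in \<mu>. The thresholds
  \<sigma>1, \<sigma>3, \<sigma>2 are the values of \<mu> at which \<nu> equals 1, 0, -1, so all five estimates follow from
  |c2| <= 1 - |c1|^2, which is Schwarz-Pick at the origin for w z / z.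
*)

theory Submission
  imports Defs
begin

section \<open>Coefficient bounds for Schwarz functions\<close>

text \<open>Composing \<open>h\<close> with the disc automorphism that moves \<open>h 0\<close> to 0
  gives a self-map \<open>g\<close> of the disc fixing 0. The Schwarz lemma yields |g'(0)| \<le> 1,
  and g'(0) = h'(0) / (1 - |h(0)|^2).\<close>

lemma schwarz_pick_origin:
  fixes h :: "complex \<Rightarrow> complex"
  assumes holo: "h holomorphic_on ball 0 1"
    and bound: "\<And>z. norm z < 1 \<Longrightarrow> norm (h z) < 1"
  shows "norm (deriv h 0) \<le> 1 - (norm (h 0))\<^sup>2"
proof -
  define c where "c = h 0"
  have c: "norm c < 1"
    using bound[of 0] by (simp add: c_def)
  have den: "1 - cnj c * z \<noteq> 0" if "norm z < 1" for z
  proof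
    assume "1 - cnj c * z = 0"
    then have "norm (cnj c * z) = 1" by simp
    moreover have "norm (cnj c * z) < 1"
      using norm_mult_less[of "cnj c" 1 z 1] c that by simp
    ultimately show False by simp
  qed
  define g where "g = Moebius_function 0 c \<circ> h"
  have g_holo: "g holomorphic_on ball 0 1"
    unfolding g_def
  proof (rule holomorphic_on_compose_gen[OF holo Moebius_function_holomorphic[OF c]])
    show "h ` ball 0 1 \<subseteq> ball 0 1"
      using bound by auto
  qed
  have g_bound: "norm (g z) < 1" if "norm z < 1" for z
    using Moebius_function_norm_lt_1[OF c bound[OF that]] by (simp add: g_def)
  have g_0: "g 0 = 0"
    by (simp add: g_def c_def Moebius_function_eq_zero)
  have dh: "(h has_field_derivative deriv h 0) (at 0)"
    using holo by (rule holomorphic_derivI) auto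
  \<comment> \<open>This is \<open>g\<close> with the Moebius map written out. As
    \<open>h 0 = c\<close>, the second term of the quotient rule vanishes and one factor
    \<open>1 - cnj c * c\<close> cancels.\<close>
  have "((\<lambda>z. (h z - c) / (1 - cnj c * h z)) has_field_derivative
      (deriv h 0 * (1 - cnj c * h 0) - (h 0 - c) * (- (cnj c * deriv h 0))) /
      ((1 - cnj c * h 0) * (1 - cnj c * h 0))) (at 0)"
    using den[OF bound[of 0]] by (auto intro!: derivative_eq_intros dh)
  then have "(g has_field_derivative deriv h 0 / (1 - cnj c * c)) (at 0)"
    using den[OF c] by (simp add: g_def o_def Moebius_function_simple c_def)
  then have "deriv g 0 = deriv h 0 / (1 - cnj c * c)"
    by (rule DERIV_imp_deriv)
  also have "1 - cnj c * c = of_real (1 - (norm c)\<^sup>2)"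
    using complex_norm_square[of c] by (simp add: mult.commute)
  finally have "norm (deriv g 0) = norm (deriv h 0) / \<bar>1 - (norm c)\<^sup>2\<bar>"
    by (simp only: norm_divide norm_of_real)
  moreover have "norm (deriv g 0) \<le> 1"
    using Schwarz_Lemma(2)[OF g_holo g_0 g_bound, of 0] by simp
  moreover have "(norm c)\<^sup>2 < 1"
    using c by (simp add: power_less_one_iff abs_square_less_1)
  ultimately show ?thesis
    using mult_right_mono[of "norm (deriv g 0)" 1 "1 - (norm c)\<^sup>2"] by (simp add: c_def)
qed

lemma schwarz_function_has_fps_expansion:
  "schwarz_function w \<Longrightarrow> w has_fps_expansion fps_expansion w 0"
  by (rule has_fps_expansion_fps_expansion[of "ball 0 1"]) (auto simp: schwarz_function_def)

text \<open>An expansion depends only on the germ at 0, so coefficients may be compared in any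
  identity that is valid on the disc.\<close>

lemma fps_expansion_unique_on_disc:
  fixes f g :: "complex \<Rightarrow> complex"
  assumes f: "f has_fps_expansion F" and g: "g has_fps_expansion G"
    and eq: "\<And>z. norm z < 1 \<Longrightarrow> f z = g z"
  shows "F = G"
proof -
  have "eventually (\<lambda>z. z \<in> ball 0 1) (nhds (0::complex))"
    by (intro eventually_nhds_in_open) auto
  then have "eventually (\<lambda>z. f z = g z) (nhds 0)"
    by eventually_elim (simp add: eq)
  from has_fps_expansion_cong[OF this refl] f have "g has_fps_expansion F"
    by simp
  then show ?thesis
    using g by (rule fps_expansion_unique_complex)
qed

text \<open>The quotient w(z)/z extends to a holomorphic \<open>h\<close> whose coefficients are
  those of \<open>w\<close> shifted by one, so the second bound is Schwarz-Pick at the origin for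
  \<open>h\<close>. That needs |h| < 1 strictly, which fails only for rotations; for those the
  second coefficient is 0.\<close>

lemma schwarz_function_coeff_bounds:
  assumes w: "schwarz_function w" and W: "w has_fps_expansion W"
  shows "norm (fps_nth W 1) \<le> 1"
    and "norm (fps_nth W 2) \<le> 1 - (norm (fps_nth W 1))\<^sup>2"
proof -
  have holo: "w holomorphic_on ball 0 1" and w0: "w 0 = 0"
    and bound: "\<And>z. norm z < 1 \<Longrightarrow> norm (w z) < 1"
    using w by (auto simp: schwarz_function_def)
  have W1: "fps_nth W 1 = deriv w 0"
    using fps_nth_fps_expansion[OF W, of 1] by simp
  show le1: "norm (fps_nth W 1) \<le> 1"
    using Schwarz_Lemma(2)[OF holo w0 bound, of 0] W1 by simp
  \<comment> \<open>The equality case of the Schwarz lemma. When it fails, the first disjunct gives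
    |h(z)| < 1 away from 0, and the second gives it at 0, where
    \<open>h 0 = deriv w 0\<close>.\<close>
  let ?rot = "(\<exists>z. norm z < 1 \<and> z \<noteq> 0 \<and> norm (w z) = norm z) \<or> norm (deriv w 0) = 1"
  show "norm (fps_nth W 2) \<le> 1 - (norm (fps_nth W 1))\<^sup>2"
  proof (cases ?rot)
    case True
    then obtain \<alpha> where \<alpha>: "\<And>z. norm z < 1 \<Longrightarrow> w z = \<alpha> * z"
      using Schwarz_Lemma(3)[OF holo w0 bound, of 0] by auto
    have "(\<lambda>z. \<alpha> * z) has_fps_expansion fps_const \<alpha> * fps_X"
      by (intro fps_expansion_intros)
    from W this \<alpha> have "W = fps_const \<alpha> * fps_X"
      by (rule fps_expansion_unique_on_disc)
    then have "fps_nth W 2 = 0" by simp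
    then show ?thesis
      using le1 by (simp add: power_le_one)
  next
    case False
    obtain h where h: "h holomorphic_on ball 0 1"
      and wh: "\<And>z. norm z < 1 \<Longrightarrow> w z = z * h z" and h0: "deriv w 0 = h 0"
      using Schwarz3[OF holo w0] by blast
    have "norm (h z) < 1" if z: "norm z < 1" for z
    proof (cases "z = 0")
      case True
      then show ?thesis
        using False le1 W1 h0 by force
    next
      case z0: False
      have "norm (w z) < norm z"
        using False z z0 Schwarz_Lemma(1)[OF holo w0 bound z] by force
      then show ?thesis
        using z0 by (simp add: wh[OF z] norm_mult)
    qed
    then have pick: "norm (deriv h 0) \<le> 1 - (norm (h 0))\<^sup>2"
      using h by (rule schwarz_pick_origin[rotated])
    define H where "H = fps_expansion h 0"
    have H: "h has_fps_expansion H"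
      unfolding H_def using h by (intro has_fps_expansion_fps_expansion[of "ball 0 1"]) auto
    have "(\<lambda>z. z * h z) has_fps_expansion fps_X * H"
      by (intro fps_expansion_intros H)
    from W this wh have "W = fps_X * H"
      by (rule fps_expansion_unique_on_disc)
    then have "fps_nth W 1 = h 0" "fps_nth W 2 = deriv h 0"
      using fps_nth_fps_expansion[OF H, of 0] fps_nth_fps_expansion[OF H, of 1] by simp_all
    then show ?thesis
      using pick by simp
  qed
qed

text \<open>Triangle inequality. The bound is affine in |c1|^2, and its slope changes sign at
  |\<nu>| = 1, which is the source of the case split in the theorem.\<close>

lemma fekete_szego_schwarz:
  fixes c1 c2 :: complex and \<nu> :: real
  assumes "norm c2 \<le> 1 - (norm c1)\<^sup>2"
  shows "norm (c2 + of_real \<nu> * c1\<^sup>2) \<le> 1 - (1 - \<bar>\<nu>\<bar>) * (norm c1)\<^sup>2"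
proof -
  have "norm (c2 + of_real \<nu> * c1\<^sup>2) \<le> norm c2 + \<bar>\<nu>\<bar> * (norm c1)\<^sup>2"
    using norm_triangle_ineq[of c2 "of_real \<nu> * c1\<^sup>2"] by (simp add: norm_mult norm_power)
  then show ?thesis
    using assms by (simp add: algebra_simps)
qed

section \<open>Expansions and low-order coefficients\<close>

text \<open>Serves to read off expansions from the series for \<open>f z - z\<close>
  (\<open>k = 2\<close>) and \<open>\<phi> z - 1\<close> (\<open>k = 1\<close>), where the first
  \<open>k\<close> terms are split off.\<close>

lemma has_fps_expansion_of_sums_tail:
  fixes g :: "complex \<Rightarrow> complex"
  assumes "\<And>z. z \<in> ball 0 1 \<Longrightarrow>
      (\<lambda>n. fps_nth F (n + k) * z ^ (n + k)) sums (g z - (\<Sum>i<k. fps_nth F i * z ^ i))"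
  shows "g has_fps_expansion F"
proof (rule has_fps_expansionI)
  have "eventually (\<lambda>z. z \<in> ball 0 1) (nhds (0::complex))"
    by (intro eventually_nhds_in_open) auto
  then show "eventually (\<lambda>z. (\<lambda>n. fps_nth F n * z ^ n) sums g z) (nhds 0)"
  proof eventually_elim
    case (elim z)
    then show ?case
      using sums_iff_shift[of "\<lambda>n. fps_nth F n * z ^ n" k] assms[OF elim] by simp
  qed
qed

text \<open>As \<open>G\<close> has no constant term, G^k starts at order k, so only k \<le> n
  contributes to coefficient n of the composition.\<close>

lemma fps_compose_nth_le_2:
  fixes F G :: "complex fps"
  assumes "fps_nth G 0 = 0"
  shows "fps_nth (F oo G) 0 = fps_nth F 0"
    and "fps_nth (F oo G) 1 = fps_nth F 1 * fps_nth G 1"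
    and "fps_nth (F oo G) 2 = fps_nth F 1 * fps_nth G 2 + fps_nth F 2 * (fps_nth G 1)\<^sup>2"
  using assms
  by (simp_all add: fps_compose_nth fps_mult_nth numeral_2_eq_2 power2_eq_square)

section \<open>Coefficient relations for (p,q)-starlike functions\<close>

text \<open>Clears the denominators \<open>f z\<close> and \<open>p - q\<close> from the
  subordination. The result is free of quotients and also holds at \<open>z = 0\<close>, so both
  sides can be expanded as power series.\<close>

lemma pq_starlike_functional_equation:
  assumes pq: "q < p"
    and pos: "\<And>z. z \<in> unit_disc \<Longrightarrow> Re (\<phi> z) > 0"
    and f: "f \<in> pq_starlike p q \<phi>" and f0: "f 0 = 0"
  obtains w where "schwarz_function w"
    and "\<And>z. z \<in> unit_disc \<Longrightarrow>
      f (of_real p * z) - f (of_real q * z) = of_real (p - q) * (f z * \<phi> (w z))"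
proof -
  obtain w where w: "schwarz_function w" and eq: "\<And>z. z \<in> unit_disc \<Longrightarrow>
      (if z = 0 then 1 else z * pq_deriv p q f z / f z) = \<phi> (w z)"
    using f by (auto simp: pq_starlike_def subordinate_def)
  have "f (of_real p * z) - f (of_real q * z) = of_real (p - q) * (f z * \<phi> (w z))"
    if z: "z \<in> unit_disc" for z
  proof (cases "z = 0")
    case True
    then show ?thesis using f0 by simp
  next
    case False
    have "w z \<in> unit_disc"
      using w z by (simp add: schwarz_function_def)
    then have "\<phi> (w z) \<noteq> 0"
      using pos by force
    moreover have quot: "\<phi> (w z) = z * pq_deriv p q f z / f z"
      using eq[OF z] False by simp
    \<comment> \<open>Division by 0 yields 0, so a zero of \<open>f\<close> would force
      \<open>\<phi> (w z) = 0\<close>, against the positive real part.\<close>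
    ultimately have "f z \<noteq> 0" by auto
    then have "f z * \<phi> (w z) = z * pq_deriv p q f z"
      using quot by simp
    then show ?thesis
      using False pq by (simp add: pq_deriv_def flip: of_real_diff)
  qed
  then show ?thesis using w that by blast
qed

text \<open>The witnesses \<open>c1\<close>, \<open>c2\<close> are the first two coefficients of the
  Schwarz function. Coefficient n of F * (P oo W) contains F_n itself because P_0 = 1; moving it to
  the left turns [n] into [n] - 1.\<close>

lemma pq_starlike_coeffs:
  fixes F P :: "complex fps"
  assumes pq: "q < p"
    and pos: "\<And>z. z \<in> unit_disc \<Longrightarrow> Re (\<phi> z) > 0"
    and f: "f \<in> pq_starlike p q \<phi>"
    and F: "f has_fps_expansion F" "fps_nth F 0 = 0" "fps_nth F 1 = 1"
    and P: "\<phi> has_fps_expansion P" "fps_nth P 0 = 1"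
  obtains c1 c2 where "norm c1 \<le> 1" "norm c2 \<le> 1 - (norm c1)\<^sup>2"
    and "of_real (pq_num p q 2 - 1) * fps_nth F 2 = fps_nth P 1 * c1"
    and "of_real (pq_num p q 3 - 1) * fps_nth F 3 =
      fps_nth P 1 * c2 + fps_nth P 2 * c1\<^sup>2 + fps_nth P 1 * c1 * fps_nth F 2"
proof -
  have f0: "f 0 = 0"
    using has_fps_expansion_imp_0_eq_fps_nth_0[OF F(1)] F(2) by simp
  obtain w where w: "schwarz_function w"
    and eq: "\<And>z. z \<in> unit_disc \<Longrightarrow>
      f (of_real p * z) - f (of_real q * z) = of_real (p - q) * (f z * \<phi> (w z))"
    using pq_starlike_functional_equation[OF pq pos f f0] by blast
  define W where "W = fps_expansion w 0"
  have W: "w has_fps_expansion W"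
    unfolding W_def using w by (rule schwarz_function_has_fps_expansion)
  have W0: "fps_nth W 0 = 0"
    using has_fps_expansion_imp_0_eq_fps_nth_0[OF W] w by (simp add: schwarz_function_def)
  have scale: "(\<lambda>z. f (c * z)) has_fps_expansion (F oo (fps_const c * fps_X))" for c
  proof -
    have "(\<lambda>z. c * z) has_fps_expansion fps_const c * fps_X"
      by (intro fps_expansion_intros)
    from has_fps_expansion_compose[OF F(1) this] show ?thesis
      by (simp add: o_def)
  qed
  define L where "L = (F oo (fps_const (of_real p) * fps_X)) - (F oo (fps_const (of_real q) * fps_X))"
  define R where "R = fps_const (of_real (p - q)) * (F * (P oo W))"
  have L: "(\<lambda>z. f (of_real p * z) - f (of_real q * z)) has_fps_expansion L"
    unfolding L_def by (intro fps_expansion_intros scale)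
  have R: "(\<lambda>z. of_real (p - q) * (f z * \<phi> (w z))) has_fps_expansion R"
    using has_fps_expansion_compose[OF P(1) W W0]
    unfolding R_def o_def by (intro fps_expansion_intros F)
  have LR: "L = R"
    using L R by (rule fps_expansion_unique_on_disc) (simp add: eq)
  \<comment> \<open>Replacing z by p z multiplies coefficient n by p^n. Dividing p^n - q^n by p - q
    produces [n].\<close>
  have coeff: "of_real (pq_num p q n) * fps_nth F n = fps_nth (F * (P oo W)) n" for n
  proof -
    have "of_real (p ^ n - q ^ n) * fps_nth F n = fps_nth L n"
      by (simp add: L_def fps_compose_linear left_diff_distrib)
    also have "\<dots> = of_real (p - q) * fps_nth (F * (P oo W)) n"
      unfolding LR R_def by (rule fps_mult_left_const_nth)
    finally show ?thesis
      using pq by (simp add: pq_num_def field_simps flip: of_real_diff)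
  qed
  show ?thesis
  proof (rule that)
    show "norm (fps_nth W 1) \<le> 1" "norm (fps_nth W 2) \<le> 1 - (norm (fps_nth W 1))\<^sup>2"
      using schwarz_function_coeff_bounds[OF w W] by simp_all
    note comp = fps_compose_nth_le_2[OF W0, of P]
    show "of_real (pq_num p q 2 - 1) * fps_nth F 2 = fps_nth P 1 * fps_nth W 1"
      using coeff[of 2] F(2,3) P(2) comp
      by (simp add: fps_mult_nth numeral_2_eq_2 algebra_simps)
    show "of_real (pq_num p q 3 - 1) * fps_nth F 3 =
      fps_nth P 1 * fps_nth W 2 + fps_nth P 2 * (fps_nth W 1)\<^sup>2
        + fps_nth P 1 * fps_nth W 1 * fps_nth F 2"
      using coeff[of 3] F(2,3) P(2) comp
      by (simp add: fps_mult_nth numeral_2_eq_2 numeral_3_eq_3 algebra_simps)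
  qed
qed

text \<open>Here [2] = p + q and [3] = p^2 + p q + q^2, so [2]^2 = [3] + p q > 1. This makes the
  other denominator of the theorem positive as well.\<close>

lemma pq_num_2_gt_1:
  assumes "0 < q" "q < p" "pq_num p q 3 > 1"
  shows "pq_num p q 2 > 1"
proof -
  have num2: "pq_num p q 2 = p + q"
    using assms(2) by (simp add: pq_num_def field_simps power2_eq_square)
  have "pq_num p q 3 = p\<^sup>2 + p * q + q\<^sup>2"
    using assms(2) by (simp add: pq_num_def field_simps power2_eq_square power3_eq_cube)
  then have "(p + q)\<^sup>2 = pq_num p q 3 + p * q"
    by (simp add: power2_eq_square algebra_simps)
  moreover have "p * q > 0"
    using assms by simp
  ultimately have "1\<^sup>2 < (p + q)\<^sup>2"
    using assms(3) by simp
  then show ?thesis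
    using assms(1,2) num2 power_less_imp_less_base by fastforce
qed

section \<open>The Fekete-Szego estimates\<close>

text \<open>The hypothesis \<open>pq_num p q 3 > 1\<close> fixes the sign of the denominators: for
  small p and q, [3] - 1 can be negative, and then b_1 / ([3] - 1) cannot bound a modulus.\<close>

theorem theorem3p1:
  fixes p q \<mu> \<sigma>1 \<sigma>2 \<sigma>3 :: real
    and \<phi> f :: "complex \<Rightarrow> complex"
    and b :: "nat \<Rightarrow> real"
    and a :: "nat \<Rightarrow> complex"
  assumes "0 < q" "q < p" "p \<le> 1"
    and "pq_num p q 3 > 1"
    and "\<phi> holomorphic_on unit_disc"
    and "\<And>z. z \<in> unit_disc \<Longrightarrow> Re (\<phi> z) > 0"
    and "\<phi> 0 = 1"
    and "deriv \<phi> 0 \<in> \<real>" "Re (deriv \<phi> 0) > 0"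
    and "\<And>z. z \<in> unit_disc \<Longrightarrow>
           (\<lambda>n. of_real (b (n + 1)) * z ^ (n + 1)) sums (\<phi> z - 1)"
    and "b 1 > 0" "b 2 \<ge> 0"
    and "\<sigma>1 = ((pq_num p q 2 - 1) * (b 1)\<^sup>2 + (pq_num p q 2 - 1)\<^sup>2 * (b 2 - b 1))
              / ((pq_num p q 3 - 1) * (b 1)\<^sup>2)"
    and "\<sigma>2 = ((pq_num p q 2 - 1) * (b 1)\<^sup>2 + (pq_num p q 2 - 1)\<^sup>2 * (b 2 + b 1))
              / ((pq_num p q 3 - 1) * (b 1)\<^sup>2)"
    and "\<sigma>3 = ((pq_num p q 2 - 1) * (b 1)\<^sup>2 + (pq_num p q 2 - 1)\<^sup>2 * b 2)
              / ((pq_num p q 3 - 1) * (b 1)\<^sup>2)"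
    and "f \<in> pq_starlike p q \<phi>"
    and "\<And>z. z \<in> unit_disc \<Longrightarrow> (\<lambda>n. a (n + 2) * z ^ (n + 2)) sums (f z - z)"
  shows
    "(\<mu> \<le> \<sigma>1 \<longrightarrow>
        norm (a 3 - of_real \<mu> * (a 2)\<^sup>2)
          \<le> b 2 / (pq_num p q 3 - 1)
            + (b 1)\<^sup>2 / (pq_num p q 2 - 1)
              * (1 / (pq_num p q 3 - 1) - \<mu> / (pq_num p q 2 - 1)))
   \<and> (\<sigma>1 \<le> \<mu> \<and> \<mu> \<le> \<sigma>2 \<longrightarrow>
        norm (a 3 - of_real \<mu> * (a 2)\<^sup>2) \<le> b 1 / (pq_num p q 3 - 1))
   \<and> (\<mu> \<ge> \<sigma>2 \<longrightarrow>
        norm (a 3 - of_real \<mu> * (a 2)\<^sup>2)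
          \<le> - b 2 / (pq_num p q 3 - 1)
            - (b 1)\<^sup>2 / (pq_num p q 2 - 1)
              * (1 / (pq_num p q 3 - 1) - \<mu> / (pq_num p q 2 - 1)))
   \<and> (\<sigma>1 < \<mu> \<and> \<mu> \<le> \<sigma>3 \<longrightarrow>
        norm (a 3 - of_real \<mu> * (a 2)\<^sup>2)
          + (pq_num p q 2 - 1)\<^sup>2 / ((pq_num p q 3 - 1) * (b 1)\<^sup>2)
            * (b 1 - b 2 - (b 1)\<^sup>2 / (pq_num p q 2 - 1)
                 * (1 - (pq_num p q 3 - 1) / (pq_num p q 2 - 1) * \<mu>))
            * (norm (a 2))\<^sup>2
          \<le> b 1 / (pq_num p q 3 - 1))
   \<and> (\<sigma>3 \<le> \<mu> \<and> \<mu> < \<sigma>2 \<longrightarrow>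
        norm (a 3 - of_real \<mu> * (a 2)\<^sup>2)
          + (pq_num p q 2 - 1)\<^sup>2 / ((pq_num p q 3 - 1) * (b 1)\<^sup>2)
            * (b 1 + b 2 + (b 1)\<^sup>2 / (pq_num p q 2 - 1)
                 * (1 - (pq_num p q 3 - 1) / (pq_num p q 2 - 1) * \<mu>))
            * (norm (a 2))\<^sup>2
          \<le> b 1 / (pq_num p q 3 - 1))"
proof -
  define A where "A = pq_num p q 2 - 1"
  define B where "B = pq_num p q 3 - 1"
  have A: "A > 0"
    using pq_num_2_gt_1[OF assms(1,2,4)] by (simp add: A_def)
  have B: "B > 0"
    using assms(4) by (simp add: B_def)
  have b1: "b 1 > 0" by fact
  \<comment> \<open>The series hypotheses constrain \<open>a\<close> only from index 2 and
    \<open>b\<close> only from index 1, so the lower coefficients of \<open>F\<close> and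
    \<open>P\<close> are set explicitly.\<close>
  define F where "F = Abs_fps (\<lambda>n. if n = 0 then 0 else if n = 1 then 1 else a n)"
  define P where "P = Abs_fps (\<lambda>n. if n = 0 then 1 else (of_real (b n) :: complex))"
  have F: "f has_fps_expansion F"
    by (rule has_fps_expansion_of_sums_tail[of F 2])
      (use assms(17) in \<open>simp add: F_def numeral_2_eq_2\<close>)
  have P: "\<phi> has_fps_expansion P"
    by (rule has_fps_expansion_of_sums_tail[of P 1]) (use assms(10) in \<open>simp add: P_def\<close>)
  obtain c1 c2 where c: "norm c1 \<le> 1" "norm c2 \<le> 1 - (norm c1)\<^sup>2"
    and a2: "of_real A * a 2 = of_real (b 1) * c1"
    and a3: "of_real B * a 3 = of_real (b 1) * c2 + of_real (b 2) * c1\<^sup>2 + of_real (b 1) * c1 * a 2"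
    using pq_starlike_coeffs[OF assms(2,6,16) F _ _ P]
    by (auto simp: F_def P_def A_def B_def)
  \<comment> \<open>The coefficient of c1^2 left after inserting \<open>a2\<close> into
    \<open>a3\<close> and extracting the factor \<open>b 1 / B\<close> from a_3 - \<mu>
    a_2^2.\<close>
  define \<nu> where "\<nu> = b 2 / b 1 + b 1 / A - \<mu> * B * b 1 / A\<^sup>2"
  define x where "x = (norm c1)\<^sup>2"
  have x: "0 \<le> x" "x \<le> 1"
    using c(1) by (simp_all add: x_def power_le_one)
  have a2': "a 2 = of_real (b 1 / A) * c1"
    using a2 A by (simp add: field_simps)
  have b1\<nu>: "b 1 * \<nu> = b 2 + b 1 * (b 1 / A) - B * \<mu> * (b 1 / A)\<^sup>2"
    unfolding \<nu>_def using A b1 by (simp add: field_simps power2_eq_square)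
  have "of_real B * (a 3 - of_real \<mu> * (a 2)\<^sup>2)
      = of_real (b 1) * c2 + of_real (b 2 + b 1 * (b 1 / A) - B * \<mu> * (b 1 / A)\<^sup>2) * c1\<^sup>2"
    unfolding right_diff_distrib a3 a2' by (simp add: algebra_simps power2_eq_square)
  also have "\<dots> = of_real (b 1) * (c2 + of_real \<nu> * c1\<^sup>2)"
    unfolding b1\<nu>[symmetric] by (simp add: algebra_simps)
  finally have "a 3 - of_real \<mu> * (a 2)\<^sup>2 = of_real (b 1 / B) * (c2 + of_real \<nu> * c1\<^sup>2)"
    using B by (simp add: field_simps)
  then have "norm (a 3 - of_real \<mu> * (a 2)\<^sup>2) = b 1 / B * norm (c2 + of_real \<nu> * c1\<^sup>2)"
    using b1 B by (simp add: norm_mult norm_divide)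
  also have "\<dots> \<le> b 1 / B * (1 - (1 - \<bar>\<nu>\<bar>) * x)"
    using fekete_szego_schwarz[OF c(2), of \<nu>] b1 B by (intro mult_left_mono) (auto simp: x_def)
  finally have main: "norm (a 3 - of_real \<mu> * (a 2)\<^sup>2) \<le> b 1 / B * (1 - (1 - \<bar>\<nu>\<bar>) * x)" .
  \<comment> \<open>Keeps the slack (1 - |\<nu>|) x, which becomes the |a_2|^2 term of the two
    refined estimates.\<close>
  have main': "norm (a 3 - of_real \<mu> * (a 2)\<^sup>2) + b 1 / B * ((1 - \<bar>\<nu>\<bar>) * x) \<le> b 1 / B"
    using main by (simp add: right_diff_distrib)
  \<comment> \<open>The bound in \<open>main\<close> is affine in x on [0, 1]: its maximum is at x =
    0 if |\<nu>| \<le> 1 and at x = 1 if |\<nu>| \<ge> 1.\<close>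
  have small: "b 1 / B * (1 - (1 - \<bar>\<nu>\<bar>) * x) \<le> b 1 / B" if "\<bar>\<nu>\<bar> \<le> 1"
  proof -
    have "0 \<le> (1 - \<bar>\<nu>\<bar>) * x"
      using that x by simp
    then show ?thesis
      using mult_left_mono[of "1 - (1 - \<bar>\<nu>\<bar>) * x" 1 "b 1 / B"] b1 B by simp
  qed
  have large: "b 1 / B * (1 - (1 - \<bar>\<nu>\<bar>) * x) \<le> b 1 / B * \<bar>\<nu>\<bar>" if "1 \<le> \<bar>\<nu>\<bar>"
  proof -
    have "(\<bar>\<nu>\<bar> - 1) * x \<le> (\<bar>\<nu>\<bar> - 1) * 1"
      using that x by (intro mult_left_mono) auto
    then have "1 - (1 - \<bar>\<nu>\<bar>) * x \<le> \<bar>\<nu>\<bar>"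
      by (simp add: algebra_simps)
    then show ?thesis
      using b1 B by (intro mult_left_mono) auto
  qed
  \<comment> \<open>One identity for all thresholds: t = -1, 1, 0 gives \<sigma>1, \<sigma>2,
    \<sigma>3. The factor is negative, so order comparisons of \<mu> with a threshold reverse for
    \<nu>.\<close>
  have \<mu>_\<sigma>: "\<mu> - (A * (b 1)\<^sup>2 + A\<^sup>2 * (b 2 + t * b 1)) / (B * (b 1)\<^sup>2)
      = - (A\<^sup>2 / (B * b 1)) * (\<nu> + t)" for t
    unfolding \<nu>_def using A B b1 by (simp add: field_simps power2_eq_square)
  have pos: "A\<^sup>2 / (B * b 1) > 0"
    using A B b1 by simp
  have \<sigma>1: "\<mu> - \<sigma>1 = - (A\<^sup>2 / (B * b 1)) * (\<nu> - 1)"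
    using \<mu>_\<sigma>[of "-1"] assms(13) by (simp add: A_def B_def)
  have \<sigma>2: "\<mu> - \<sigma>2 = - (A\<^sup>2 / (B * b 1)) * (\<nu> + 1)"
    using \<mu>_\<sigma>[of 1] assms(14) by (simp add: A_def B_def)
  have \<sigma>3: "\<mu> - \<sigma>3 = - (A\<^sup>2 / (B * b 1)) * \<nu>"
    using \<mu>_\<sigma>[of 0] assms(15) by (simp add: A_def B_def)
  have le1: "\<mu> \<le> \<sigma>1 \<longleftrightarrow> 1 \<le> \<nu>" and ge1: "\<sigma>1 \<le> \<mu> \<longleftrightarrow> \<nu> \<le> 1"
    using \<sigma>1 pos by (smt (verit) mult_minus_left mult_less_0_iff zero_le_mult_iff)+
  have le2: "\<mu> \<le> \<sigma>2 \<longleftrightarrow> - 1 \<le> \<nu>" and ge2: "\<sigma>2 \<le> \<mu> \<longleftrightarrow> \<nu> \<le> - 1"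
    using \<sigma>2 pos by (smt (verit) mult_minus_left mult_less_0_iff zero_le_mult_iff)+
  have le3: "\<mu> \<le> \<sigma>3 \<longleftrightarrow> 0 \<le> \<nu>" and ge3: "\<sigma>3 \<le> \<mu> \<longleftrightarrow> \<nu> \<le> 0"
    using \<sigma>3 pos by (smt (verit) mult_minus_left mult_less_0_iff zero_le_mult_iff)+
  \<comment> \<open>The right side is the bound of the first case, and its negative that of the
    third; both are b_1 |\<nu>| / B there.\<close>
  have b\<nu>: "b 1 / B * \<nu> = b 2 / B + (b 1)\<^sup>2 / A * (1 / B - \<mu> / A)"
    unfolding \<nu>_def using A B b1 by (simp add: field_simps power2_eq_square)
  have bracket: "(b 1)\<^sup>2 / A * (1 - B / A * \<mu>) = b 1 * \<nu> - b 2"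
    unfolding \<nu>_def using A B b1 by (simp add: field_simps power2_eq_square)
  have "norm (a 2) = b 1 / A * norm c1"
    unfolding a2' using A b1 by (simp add: norm_mult norm_divide)
  then have "(norm (a 2))\<^sup>2 = (b 1)\<^sup>2 / A\<^sup>2 * x"
    by (simp add: x_def power_mult_distrib power_divide)
  \<comment> \<open>Used with s = 1 - \<nu> and s = 1 + \<nu>, to which the brackets of the refined
    estimates reduce after extracting \<open>b 1\<close>.\<close>
  then have a2_term: "A\<^sup>2 / (B * (b 1)\<^sup>2) * (b 1 * s) * (norm (a 2))\<^sup>2 = b 1 / B * (s * x)" for s
    using A B b1 by simp
  have case1: "norm (a 3 - of_real \<mu> * (a 2)\<^sup>2) \<le> b 2 / B + (b 1)\<^sup>2 / A * (1 / B - \<mu> / A)"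
    if "\<mu> \<le> \<sigma>1"
    using main large b\<nu> le1 that by auto
  have case2: "norm (a 3 - of_real \<mu> * (a 2)\<^sup>2) \<le> b 1 / B" if "\<sigma>1 \<le> \<mu>" "\<mu> \<le> \<sigma>2"
    using order.trans[OF main small] ge1 le2 that by (auto simp: abs_le_iff)
  have case3: "norm (a 3 - of_real \<mu> * (a 2)\<^sup>2) \<le> - b 2 / B - (b 1)\<^sup>2 / A * (1 / B - \<mu> / A)"
    if "\<mu> \<ge> \<sigma>2"
    using main large b\<nu> ge2 that by auto
  \<comment> \<open>For \<mu> \<le> \<sigma>3 one has \<nu> \<ge> 0, so 1 - |\<nu>| = 1 - \<nu> and
    \<open>main'\<close> is the claim in terms of x; \<open>case5\<close> is the mirror image with
    \<nu> \<le> 0.\<close>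
  have case4: "norm (a 3 - of_real \<mu> * (a 2)\<^sup>2)
      + A\<^sup>2 / (B * (b 1)\<^sup>2) * (b 1 - b 2 - (b 1)\<^sup>2 / A * (1 - B / A * \<mu>)) * (norm (a 2))\<^sup>2
      \<le> b 1 / B" if "\<mu> \<le> \<sigma>3"
  proof -
    have "b 1 - b 2 - (b 1)\<^sup>2 / A * (1 - B / A * \<mu>) = b 1 * (1 - \<nu>)"
      unfolding bracket by (simp add: algebra_simps)
    moreover have "1 - \<bar>\<nu>\<bar> = 1 - \<nu>"
      using le3 that by simp
    ultimately show ?thesis
      using main' a2_term[of "1 - \<nu>"] by (simp only:)
  qed
  have case5: "norm (a 3 - of_real \<mu> * (a 2)\<^sup>2)
      + A\<^sup>2 / (B * (b 1)\<^sup>2) * (b 1 + b 2 + (b 1)\<^sup>2 / A * (1 - B / A * \<mu>)) * (norm (a 2))\<^sup>2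
      \<le> b 1 / B" if "\<sigma>3 \<le> \<mu>"
  proof -
    have "b 1 + b 2 + (b 1)\<^sup>2 / A * (1 - B / A * \<mu>) = b 1 * (1 + \<nu>)"
      unfolding bracket by (simp add: algebra_simps)
    moreover have "1 - \<bar>\<nu>\<bar> = 1 + \<nu>"
      using ge3 that by simp
    ultimately show ?thesis
      using main' a2_term[of "1 + \<nu>"] by (simp only:)
  qed
  show ?thesis
    using case1 case2 case3 case4 case5 unfolding A_def B_def by blast
qed

end
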